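(* Assume that for every $1\le k\le n$ and $1\le i\le d_y$ at least one of $\underline{y}_k^{(i)},\bar{y}_k^{(i)}$ is finite. Let $z=\mu_1(\mathbf{y}_k\mid y_{1:k-1})$ be the conditional mean, and, when both $\underline{y}_k^{(i)}$ and $\bar{y}_k^{(i)}$ are finite, let $x^*$ (depending on $i$) be the non-zero solution of $$[(\bar{y}_k^{(i)}-z^{(i)})x-1]\,e^{(\bar{y}_k^{(i)}-\underline{y}_k^{(i)})x}-(\underline{y}_k^{(i)}-z^{(i)})x+1=0 .$$ Define $$\lambda_1^{(i)}=\begin{cases}\left(\underline{y}_k^{(i)}-z^{(i)}\right)^{-1},&\bar{y}_k^{(i)}=\infty,\\ \left(\bar{y}_k^{(i)}-z^{(i)}\right)^{-1},&\underline{y}_k^{(i)}=-\infty,\\ x^*,&\text{else},\end{cases}$$ $$\lambda_0^{(i)}=\begin{cases}-\log\left(z^{(i)}-\underline{y}_k^{(i)}\right)+\dfrac{\underline{y}_k^{(i)}}{z^{(i)}-\underline{y}_k^{(i)}},&\bar{y}_k^{(i)}=\infty,\\[2mm] -\log\left(\bar{y}_k^{(i)}-z^{(i)}\right)+\dfrac{\bar{y}_k^{(i)}}{z^{(i)}-\bar{y}_k^{(i)}},&\underline{y}_k^{(i)}=-\infty,\\[2mm] \log\dfrac{\lambda_1^{(i)}}{e^{\bar{y}_k^{(i)}\lambda_1^{(i)}}-e^{\underline{y}_k^{(i)}\lambda_1^{(i)}}},&\text{else}.\end{cases}$$ Then the output of the optimal first-moment robust probabilistic predictor $\mathscr{F}_k^\star$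 is the exponential distribution $$\hat{p}^\star_{\mathbf{y}_k\mid\mathbf{y}_{1:k-1}}(s\mid y_{1:k-1})=\begin{cases}\prod_{i=1}^{d_y}e^{\lambda_1^{(i)}s^{(i)}+\lambda_0^{(i)}},&s\in\operatorname{supp}(\mathbf{y}_k),\\0,&\text{else}.\end{cases}$$
   Context: System $\Phi$: $\mathbf{x}_k=f(\mathbf{x}_{k-1},\mathbf{u}_{k-1})+\mathbf{w}_{k-1}$, $\mathbf{y}_k=h(\mathbf{x}_k)+\mathbf{v}_k$, with outputs $\mathbf{y}_k\in\mathbb{R}^{d_y}$, independent noises $\mathbf{w}_k,\mathbf{v}_k$, no cross-correlation among $\mathbf{w}_k,\mathbf{v}_k,\mathbf{u}_k$, and $\mathbf{x}_0$ independent of them. $p_{\mathbf{y}_k\mid\mathbf{y}_{1:k-1}}$ is the true conditional density of $\mathbf{y}_k$; $\mu_1(\mathbf{y}_k\mid y_{1:k-1})=\int s\,p_{\mathbf{y}_k\mid\mathbf{y}_{1:k-1}}(s\mid y_{1:k-1})\,\mathrm{d}s$. $\operatorname{supp}(\mathbf{y}_k)=\{v\in\mathbb{R}^{d_y}\mid\underline{y}_k^{(i)}\le v^{(i)}\le\bar{y}_k^{(i)},\,1\le i\le d_y\}$ with $\underline{y}_k^{(i)},\bar{y}_k^{(i)}\in\mathbb{R}\cup\{\pm\infty\}$. Superscript $(i)$ denotes the $i$-th component. For a multi-index $\alpha$, $s^\alpha=\prod_i(s^{(i)})^{\alpha^{(i)}}$ and $|\alpha|=\sum_i\alpha^{(i)}$.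 The $m$-th moment information set is $\mathcal{I}_m:=\{|\mu_\alpha(\mathbf{v})|<\infty,\ \forall\,\mathbf{v}\in\{\mathbf{w}_{1:n},\mathbf{v}_{1:n},\mathbf{u}_{1:n},\mathbf{x}_0\},\ |\alpha|\le m\}$, with $\mu_\alpha(\mathbf{v})=\int s^\alpha p_{\mathbf{v}}(s)\,\mathrm{d}s$. An $m$-th moment robust probabilistic predictor is a predictor $\mathscr{F}=(\mathscr{F}_k)$ whose time-$k$ output $\mathscr{F}_k(y_{1:k-1};\mathcal{I}_m)=\hat{p}_{\mathbf{y}_k\mid\mathbf{y}_{1:k-1}}(\cdot\mid y_{1:k-1})$ is a probability density of the form $s\mapsto e^{\sum_{i=0}^m\sum_{|\alpha|=i}\lambda_\alpha s^\alpha}$ on $\operatorname{supp}(\mathbf{y}_k)$ (zero elsewhere), $\lambda_\alpha\in\mathbb{R}$. "First-moment" means $m=1$. It is optimal if the parameters maximize the one-step expected log-likelihood $\int p_{\mathbf{y}_k\mid\mathbf{y}_{1:k-1}}(s\mid y_{1:k-1})\log\hat{p}_{\mathbf{y}_k\mid\mathbf{y}_{1:k-1}}(s\mid y_{1:k-1})\,\mathrm{d}s$ among densities of this form. *)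

theory Defs
  imports "HOL-Probability.Probability"
begin

definition mi_deg :: "nat ^ 'd \<Rightarrow> nat" where
  "mi_deg \<alpha> = (\<Sum>i\<in>UNIV. \<alpha> $ i)"

definition mi_power :: "real ^ 'd \<Rightarrow> nat ^ 'd \<Rightarrow> real" where
  "mi_power s \<alpha> = (\<Prod>i\<in>UNIV. (s $ i) ^ (\<alpha> $ i))"

definition has_density :: "'a measure \<Rightarrow> ('a \<Rightarrow> real ^ 'd) \<Rightarrow> (real ^ 'd \<Rightarrow> real) \<Rightarrow> bool" where
  "has_density M X p \<longleftrightarrow> (\<forall>s. 0 \<le> p s) \<and> distributed M lborel X (\<lambda>s. ennreal (p s))"

text \<open>Finiteness of a moment is integrability of the integrand: the Bochner integral alone
  would be 0 for a divergent moment.  The choice of the density is immaterial, since densities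
  agree almost everywhere.\<close>

definition finite_moments :: "nat \<Rightarrow> 'a measure \<Rightarrow> ('a \<Rightarrow> real ^ 'd) \<Rightarrow> bool" where
  "finite_moments m M X \<longleftrightarrow>
     (\<exists>p. has_density M X p \<and>
        (\<forall>\<alpha>. mi_deg \<alpha> \<le> m \<longrightarrow> integrable lborel (\<lambda>s. mi_power s \<alpha> * p s)))"

definition moment_info ::
  "nat \<Rightarrow> 'a measure \<Rightarrow> nat \<Rightarrow> (nat \<Rightarrow> 'a \<Rightarrow> real ^ 'dx) \<Rightarrow> (nat \<Rightarrow> 'a \<Rightarrow> real ^ 'dy)
    \<Rightarrow> (nat \<Rightarrow> 'a \<Rightarrow> real ^ 'du) \<Rightarrow> ('a \<Rightarrow> real ^ 'dx) \<Rightarrow> bool" where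
  "moment_info m M n w v u x0 \<longleftrightarrow>
     (\<forall>k\<in>{1..n}. finite_moments m M (w k) \<and> finite_moments m M (v k) \<and> finite_moments m M (u k))
     \<and> finite_moments m M x0"

text \<open>Topological support of the law of a random vector.\<close>

definition rv_support :: "'a measure \<Rightarrow> ('a \<Rightarrow> real ^ 'd) \<Rightarrow> (real ^ 'd) set" where
  "rv_support M X =
     {c. \<forall>U. open U \<longrightarrow> c \<in> U \<longrightarrow> 0 < measure M (X -` U \<inter> space M)}"

definition ebox :: "ereal ^ 'd \<Rightarrow> ereal ^ 'd \<Rightarrow> (real ^ 'd) set" where
  "ebox lo up = {c. \<forall>i. lo $ i \<le> ereal (c $ i) \<and> ereal (c $ i) \<le> up $ i}"

definition uncorrelated ::
  "'a measure \<Rightarrow> ('a \<Rightarrow> real ^ 'c) \<Rightarrow> ('a \<Rightarrow> real ^ 'd) \<Rightarrow> bool" where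
  "uncorrelated M X Y \<longleftrightarrow>
     (\<forall>i j. integrable M (\<lambda>\<omega>. X \<omega> $ i * Y \<omega> $ j) \<and>
        (\<integral>\<omega>. X \<omega> $ i * Y \<omega> $ j \<partial>M) = (\<integral>\<omega>. X \<omega> $ i \<partial>M) * (\<integral>\<omega>. Y \<omega> $ j \<partial>M))"

text \<open>Independence is stated for the generated \<open>\<sigma>\<close>-algebras because the
  vectors involved have different dimensions, hence different types.\<close>

abbreviation sigma_of :: "'a measure \<Rightarrow> 'b measure \<Rightarrow> ('a \<Rightarrow> 'b) \<Rightarrow> 'a set set" where
  "sigma_of M N X \<equiv> sets (vimage_algebra (space M) X N)"

locale stochastic_system = prob_space M
  for M :: "'a measure" and n :: nat
    and f :: "real ^ 'dx \<Rightarrow> real ^ 'du \<Rightarrow> real ^ 'dx"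
    and h :: "real ^ 'dx \<Rightarrow> real ^ 'dy"
    and x :: "nat \<Rightarrow> 'a \<Rightarrow> real ^ 'dx"
    and u :: "nat \<Rightarrow> 'a \<Rightarrow> real ^ 'du"
    and w :: "nat \<Rightarrow> 'a \<Rightarrow> real ^ 'dx"
    and v :: "nat \<Rightarrow> 'a \<Rightarrow> real ^ 'dy"
    and y :: "nat \<Rightarrow> 'a \<Rightarrow> real ^ 'dy" +
  assumes measurable_f: "(\<lambda>(a, b). f a b) \<in> borel_measurable borel"
    and measurable_h: "h \<in> borel_measurable borel"
    and rv_x0: "x 0 \<in> borel_measurable M"
    and rv_u: "k \<in> {0..n} \<Longrightarrow> u k \<in> borel_measurable M"
    and rv_w: "k \<in> {0..n} \<Longrightarrow> w k \<in> borel_measurable M"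
    and rv_v: "k \<in> {1..n} \<Longrightarrow> v k \<in> borel_measurable M"
    and state_eq: "k \<in> {1..n} \<Longrightarrow> \<omega> \<in> space M \<Longrightarrow>
      x k \<omega> = f (x (k - 1) \<omega>) (u (k - 1) \<omega>) + w (k - 1) \<omega>"
    and output_eq: "k \<in> {1..n} \<Longrightarrow> \<omega> \<in> space M \<Longrightarrow> y k \<omega> = h (x k \<omega>) + v k \<omega>"
    and indep_noises:
      "indep_sets (\<lambda>j. case j of Inl k \<Rightarrow> sigma_of M borel (w k) | Inr k \<Rightarrow> sigma_of M borel (v k))
         (Inl ` {0..n} \<union> Inr ` {1..n})"
    and uncorrelated_wv: "k \<in> {1..n} \<Longrightarrow> uncorrelated M (w k) (v k)"
    and uncorrelated_wu: "k \<in> {0..n} \<Longrightarrow> uncorrelated M (w k) (u k)"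
    and uncorrelated_vu: "k \<in> {1..n} \<Longrightarrow> uncorrelated M (v k) (u k)"
    and indep_x0:
      "indep_set (sigma_of M borel (x 0))
         (sigma_of M
            (PiM {0..n} (\<lambda>_. borel) \<Otimes>\<^sub>M PiM {1..n} (\<lambda>_. borel) \<Otimes>\<^sub>M PiM {0..n} (\<lambda>_. borel))
            (\<lambda>\<omega>. (\<lambda>k\<in>{0..n}. w k \<omega>, \<lambda>k\<in>{1..n}. v k \<omega>, \<lambda>k\<in>{0..n}. u k \<omega>)))"

definition history_law ::
  "'a measure \<Rightarrow> (nat \<Rightarrow> 'a \<Rightarrow> real ^ 'dy) \<Rightarrow> nat \<Rightarrow> (nat \<Rightarrow> real ^ 'dy) measure" where
  "history_law M y k = distr M (PiM {1..<k} (\<lambda>_. borel)) (\<lambda>\<omega>. \<lambda>j\<in>{1..<k}. y j \<omega>)"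

text \<open>\<open>p ys s\<close> is a version of the density of \<open>y k\<close> at \<open>s\<close> given that the outputs
  \<open>y 1, \<dots>, y (k - 1)\<close> equal \<open>ys\<close>: it is the density of the joint law of history and current
  output relative to the product of the law of the history and Lebesgue measure.  No density of
  the history itself is needed.\<close>

definition cond_density ::
  "'a measure \<Rightarrow> (nat \<Rightarrow> 'a \<Rightarrow> real ^ 'dy) \<Rightarrow> nat
    \<Rightarrow> ((nat \<Rightarrow> real ^ 'dy) \<Rightarrow> real ^ 'dy \<Rightarrow> real) \<Rightarrow> bool" where
  "cond_density M y k p \<longleftrightarrow>
     (\<forall>ys s. 0 \<le> p ys s) \<and>
     distributed M (history_law M y k \<Otimes>\<^sub>M lborel) (\<lambda>\<omega>. (\<lambda>j\<in>{1..<k}. y j \<omega>, y k \<omega>))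
       (\<lambda>(ys, s). ennreal (p ys s))"

definition has_mean :: "(real ^ 'd \<Rightarrow> real) \<Rightarrow> bool" where
  "has_mean p \<longleftrightarrow> integrable lborel (\<lambda>s. p s *\<^sub>R s)"

definition mean :: "(real ^ 'd \<Rightarrow> real) \<Rightarrow> real ^ 'd" where
  "mean p = (\<integral>s. p s *\<^sub>R s \<partial>lborel)"

text \<open>A predictor maps a time \<open>k\<close> and an output history to a function on the output space.\<close>

type_synonym 'd predictor = "nat \<Rightarrow> (nat \<Rightarrow> real ^ 'd) \<Rightarrow> real ^ 'd \<Rightarrow> real"

definition exp_poly_density :: "nat \<Rightarrow> (real ^ 'd) set \<Rightarrow> (real ^ 'd \<Rightarrow> real) \<Rightarrow> bool" where
  "exp_poly_density m S q \<longleftrightarrow>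
     (\<exists>c. q = (\<lambda>s. if s \<in> S
        then exp (\<Sum>i=0..m. \<Sum>\<alpha> | mi_deg \<alpha> = i. c \<alpha> * mi_power s \<alpha>) else 0)) \<and>
     prob_space (density lborel (\<lambda>s. ennreal (q s)))"

text \<open>Meaningful if \<open>p\<close> vanishes almost everywhere outside \<open>S\<close> and has finite moments up to
  order \<open>m\<close>; then the integrand is integrable for every \<open>q\<close> with \<open>exp_poly_density m S q\<close>.\<close>

definition exp_log_likelihood :: "(real ^ 'd \<Rightarrow> real) \<Rightarrow> (real ^ 'd \<Rightarrow> real) \<Rightarrow> real" where
  "exp_log_likelihood p q = (\<integral>s. p s * ln (q s) \<partial>lborel)"

definition robust_predictor_at ::
  "nat \<Rightarrow> 'a measure \<Rightarrow> (nat \<Rightarrow> 'a \<Rightarrow> real ^ 'd) \<Rightarrow> 'd predictor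
    \<Rightarrow> nat \<Rightarrow> (nat \<Rightarrow> real ^ 'd) \<Rightarrow> bool" where
  "robust_predictor_at m M y F k ys \<longleftrightarrow> exp_poly_density m (rv_support M (y k)) (F k ys)"

definition optimal_robust_predictor_at ::
  "nat \<Rightarrow> 'a measure \<Rightarrow> (nat \<Rightarrow> 'a \<Rightarrow> real ^ 'd) \<Rightarrow> (real ^ 'd \<Rightarrow> real) \<Rightarrow> 'd predictor
    \<Rightarrow> nat \<Rightarrow> (nat \<Rightarrow> real ^ 'd) \<Rightarrow> bool" where
  "optimal_robust_predictor_at m M y p F k ys \<longleftrightarrow>
     robust_predictor_at m M y F k ys \<and>
     (\<forall>q. exp_poly_density m (rv_support M (y k)) q \<longrightarrow>
        exp_log_likelihood p q \<le> exp_log_likelihood p (F k ys))"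

definition nonzero_root :: "real \<Rightarrow> real \<Rightarrow> real \<Rightarrow> real \<Rightarrow> bool" where
  "nonzero_root a b z r \<longleftrightarrow>
     r \<noteq> 0 \<and> ((b - z) * r - 1) * exp ((b - a) * r) - (a - z) * r + 1 = 0"

definition lambda1 :: "ereal \<Rightarrow> ereal \<Rightarrow> real \<Rightarrow> real \<Rightarrow> real" where
  "lambda1 lo up z r =
     (if up = \<infinity> then inverse (real_of_ereal lo - z)
      else if lo = -\<infinity> then inverse (real_of_ereal up - z)
      else r)"

definition lambda0 :: "ereal \<Rightarrow> ereal \<Rightarrow> real \<Rightarrow> real \<Rightarrow> real" where
  "lambda0 lo up z r =
     (let a = real_of_ereal lo; b = real_of_ereal up; l = lambda1 lo up z r in
      if up = \<infinity> then - ln (z - a) + a / (z - a)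
      else if lo = -\<infinity> then - ln (b - z) + b / (z - b)
      else ln (l / (exp (b * l) - exp (a * l))))"

definition robust_exp_density ::
  "(real ^ 'd) set \<Rightarrow> ereal ^ 'd \<Rightarrow> ereal ^ 'd \<Rightarrow> real ^ 'd \<Rightarrow> real ^ 'd \<Rightarrow> real ^ 'd \<Rightarrow> real" where
  "robust_exp_density S lo up z xs s =
     (if s \<in> S
      then \<Prod>i\<in>UNIV. exp (lambda1 (lo $ i) (up $ i) (z $ i) (xs $ i) * s $ i
                         + lambda0 (lo $ i) (up $ i) (z $ i) (xs $ i))
      else 0)"

end

theory Submission
  imports Defs "HOL-Real_Asymp.Real_Asymp"
begin

text \<open>Within the exponential family the expected log-likelihood of \<open>e\<^bsup>c\<^sub>0 + c \<bullet> s\<^esup>\<close> is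
  \<open>c\<^sub>0 + c \<bullet> z\<close>, so it depends on the true conditional density only through its mean \<open>z\<close>. The
  defining equations of \<open>\<lambda>\<^sub>0\<close> and \<open>\<lambda>\<^sub>1\<close> say exactly that the claimed density \<open>q\<close> is normalised and
  has mean \<open>z\<close>. Hence the expected log-likelihoods can be computed with \<open>q\<close> in place of the true
  density, and Gibbs' inequality shows that \<open>q\<close> is the maximiser. Equality forces the two affine
  exponents to agree almost everywhere on a set of positive measure, hence everywhere, since a
  hyperplane is a null set.\<close>

section \<open>Support of a law and sections of the conditional density\<close>

text \<open>The complement of the support is the union of all open sets of measure zero. By
  Lindelof, countably many of them already cover it, so it carries no mass either.\<close>

lemma AE_in_rv_support:
  assumes "prob_space M" and [measurable]: "X \<in> borel_measurable M"
  shows "AE \<omega> in M. X \<omega> \<in> rv_support M X"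
proof -
  interpret prob_space M by fact
  let ?F = "{U. open U \<and> measure M (X -` U \<inter> space M) = 0}"
  obtain F' where F': "F' \<subseteq> ?F" "countable F'" "\<Union>F' = \<Union>?F"
    using Lindelof[of ?F] by auto
  have "AE \<omega> in M. \<forall>U\<in>F'. X \<omega> \<notin> U"
  proof (subst AE_ball_countable[OF F'(2)], rule ballI)
    fix U assume "U \<in> F'"
    then have [measurable]: "open U" and null: "measure M (X -` U \<inter> space M) = 0" using F' by auto
    have "X -` U \<inter> space M \<in> sets M" using \<open>open U\<close> by measurable
    then have "X -` U \<inter> space M \<in> null_sets M"
      using null by (simp add: null_sets_def emeasure_eq_measure)
    then show "AE \<omega> in M. X \<omega> \<notin> U" by (rule AE_I') auto
  qed
  then show ?thesis
  proof (rule AE_mp, intro AE_I2 impI)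
    fix \<omega> assume "\<forall>U\<in>F'. X \<omega> \<notin> U"
    then have "X \<omega> \<notin> \<Union>?F" using F'(3) by auto
    then show "X \<omega> \<in> rv_support M X"
      unfolding rv_support_def by (auto simp: zero_less_measure_iff)
  qed
qed

text \<open>\<open>cond_density\<close> only describes the joint law of history and output. Its
  integral over \<open>A \<times> UNIV\<close> gives back the law of the history, and its integral
  over the outputs outside the support is 0. Fubini then passes to almost every single
  history.\<close>

lemma AE_cond_density:
  assumes "prob_space M" and "cond_density M y k p"
    and [measurable]: "rv_support M (y k) \<in> sets borel"
  shows "AE ys in history_law M y k. p ys \<in> borel_measurable borel \<and>
    (\<integral>\<^sup>+ s. ennreal (p ys s) \<partial>lborel) = 1 \<and> (AE s in lborel. s \<notin> rv_support M (y k) \<longrightarrow> p ys s = 0)"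
proof -
  interpret prob_space M by fact
  let ?H = "history_law M y k" and ?S = "rv_support M (y k)"
  let ?hist = "\<lambda>\<omega>. \<lambda>j\<in>{1..<k}. y j \<omega>"
  note c = assms(2)[unfolded cond_density_def distributed_def]
  have p0: "0 \<le> p ys s" for ys s using c by auto
  have setsH[measurable_cong]: "sets ?H = sets (PiM {1..<k} (\<lambda>_. borel))"
    by (simp add: history_law_def)
  have XY: "(\<lambda>\<omega>. (?hist \<omega>, y k \<omega>)) \<in> M \<rightarrow>\<^sub>M ?H \<Otimes>\<^sub>M lborel" using c by auto
  have hist: "?hist \<in> M \<rightarrow>\<^sub>M PiM {1..<k} (\<lambda>_. borel)"
    using measurable_comp[OF XY measurable_fst] unfolding comp_def fst_conv
    by (simp add: measurable_cong_sets[OF refl setsH])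
  have yk[measurable]: "y k \<in> M \<rightarrow>\<^sub>M borel"
    using measurable_comp[OF XY measurable_snd] by (simp add: comp_def)
  interpret H: prob_space ?H
    unfolding history_law_def by (rule prob_space_distr[OF hist])
  interpret HL: pair_sigma_finite ?H "lborel :: (real ^ 'b) measure" ..
  have pm[measurable]: "(\<lambda>(ys, s). ennreal (p ys s)) \<in> borel_measurable (?H \<Otimes>\<^sub>M lborel)"
    using c by auto
  have em: "emeasure M ((\<lambda>\<omega>. (?hist \<omega>, y k \<omega>)) -` A \<inter> space M)
      = (\<integral>\<^sup>+ z. (case z of (ys, s) \<Rightarrow> ennreal (p ys s)) * indicator A z \<partial>(?H \<Otimes>\<^sub>M lborel))"
    if "A \<in> sets (?H \<Otimes>\<^sub>M lborel)" for A
    using that c XY pm by (subst emeasure_distr[symmetric, OF XY that]) (simp add: emeasure_density)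
  have meas: "p ys \<in> borel_measurable borel" if "ys \<in> space ?H" for ys
  proof -
    have "(\<lambda>s. ennreal (p ys s)) \<in> borel_measurable lborel"
      using measurable_compose[OF measurable_Pair1'[OF that] pm] by simp
    then have "(\<lambda>s. enn2real (ennreal (p ys s))) \<in> borel_measurable lborel" by measurable
    then show ?thesis using p0 by simp
  qed
  have one: "AE ys in ?H. (\<integral>\<^sup>+ s. ennreal (p ys s) \<partial>lborel) = 1"
  proof -
    \<comment> \<open>Both sides are densities of the law of the history with respect to itself, so
      uniqueness of densities makes the inner integral 1 almost everywhere.\<close>
    have "density ?H (\<lambda>ys. \<integral>\<^sup>+ s. ennreal (p ys s) \<partial>lborel) = density ?H (\<lambda>_. 1)"
    proof (rule measure_eqI)
      fix A assume "A \<in> sets (density ?H (\<lambda>ys. \<integral>\<^sup>+ s. ennreal (p ys s) \<partial>lborel))"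
      then have A[measurable]: "A \<in> sets ?H" by simp
      have "emeasure ?H A = emeasure M (?hist -` A \<inter> space M)"
        using A setsH unfolding history_law_def by (subst emeasure_distr[OF hist]) auto
      also have "?hist -` A \<inter> space M = (\<lambda>\<omega>. (?hist \<omega>, y k \<omega>)) -` (A \<times> UNIV) \<inter> space M"
        by auto
      also have "emeasure M \<dots> = (\<integral>\<^sup>+ z. (case z of (ys, s) \<Rightarrow> ennreal (p ys s)) * indicator (A \<times> UNIV) z \<partial>(?H \<Otimes>\<^sub>M lborel))"
        by (rule em) (use A in \<open>intro pair_measureI; simp\<close>)
      also have "\<dots> = (\<integral>\<^sup>+ ys. (\<integral>\<^sup>+ s. ennreal (p ys s) \<partial>lborel) * indicator A ys \<partial>?H)"
      proof -
        have AU[measurable]: "A \<times> UNIV \<in> sets (?H \<Otimes>\<^sub>M lborel)"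
          using A by (intro pair_measureI) simp_all
        have "(\<integral>\<^sup>+ s. ennreal (p ys s) * indicator (A \<times> UNIV) (ys, s) \<partial>lborel)
            = (\<integral>\<^sup>+ s. ennreal (p ys s) \<partial>lborel) * indicator A ys" if "ys \<in> space ?H" for ys
          using meas[OF that] by (cases "ys \<in> A") auto
        then show ?thesis
          by (subst lborel.nn_integral_fst[symmetric]) (auto intro!: nn_integral_cong)
      qed
      finally show "emeasure (density ?H (\<lambda>ys. \<integral>\<^sup>+ s. ennreal (p ys s) \<partial>lborel)) A = emeasure (density ?H (\<lambda>_. 1)) A"
        by (simp add: emeasure_density)
    qed simp
    then show ?thesis
      by (subst (asm) H.density_unique_iff) auto
  qed
  have supp: "AE ys in ?H. AE s in lborel. s \<notin> ?S \<longrightarrow> p ys s = 0"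
  proof -
    have "AE \<omega> in M. y k \<omega> \<in> ?S" by (rule AE_in_rv_support) (fact | simp)+
    then have "emeasure M {\<omega> \<in> space M. y k \<omega> \<notin> ?S} = 0"
      by (subst (asm) AE_iff_measurable[OF _ refl]) auto
    also have "{\<omega> \<in> space M. y k \<omega> \<notin> ?S} = (\<lambda>\<omega>. (?hist \<omega>, y k \<omega>)) -` (space ?H \<times> - ?S) \<inter> space M"
      using measurable_space[OF XY] by (auto simp: space_pair_measure)
    finally have "(\<integral>\<^sup>+ z. (case z of (ys, s) \<Rightarrow> ennreal (p ys s)) * indicator (space ?H \<times> - ?S) z \<partial>(?H \<Otimes>\<^sub>M lborel)) = 0"
      by (subst (asm) em) auto
    then have "AE z in ?H \<Otimes>\<^sub>M lborel. (case z of (ys, s) \<Rightarrow> ennreal (p ys s)) * indicator (space ?H \<times> - ?S) z = 0"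
      by (subst (asm) nn_integral_0_iff_AE) auto
    then have "AE z in ?H \<Otimes>\<^sub>M lborel. snd z \<notin> ?S \<longrightarrow> p (fst z) (snd z) = 0"
      by (rule AE_mp, intro AE_I2)
        (use p0 in \<open>auto simp: space_pair_measure indicator_def ennreal_eq_0_iff intro: antisym split: if_splits\<close>)
    \<comment> \<open>A null set of the product has null sections over almost every history.\<close>
    from HL.AE_pair[OF this] show ?thesis by simp
  qed
  show ?thesis using one supp AE_space by eventually_elim (use meas in auto)
qed

section \<open>Exponentials of affine functions as the case of degree one\<close>

text \<open>The exponents of \<open>exp_poly_density\<close> for \<open>m = 1\<close>, written as an
  inner product so that a mean can be inserted for \<open>s\<close>. Normalisation is kept
  apart.\<close>

definition exp_affine :: "(real ^ 'd) set \<Rightarrow> real \<Rightarrow> real ^ 'd \<Rightarrow> real ^ 'd \<Rightarrow> real" where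
  "exp_affine S c0 c s = (if s \<in> S then exp (c0 + c \<bullet> s) else 0)"

lemma exp_affine_nonneg: "0 \<le> exp_affine S c0 c s"
  by (simp add: exp_affine_def)

lemma borel_measurable_exp_affine [measurable]:
  "S \<in> sets borel \<Longrightarrow> exp_affine S c0 c \<in> borel_measurable borel"
  unfolding exp_affine_def[abs_def] by (measurable, simp_all)

lemma mi_deg_eq_0_iff: "mi_deg \<alpha> = 0 \<longleftrightarrow> \<alpha> = 0"
  by (auto simp: mi_deg_def vec_eq_iff)

lemma mi_deg_eq_1: "{\<alpha>. mi_deg \<alpha> = 1} = range (\<lambda>i. axis i 1)"
proof -
  have "\<exists>i. \<alpha> = axis i 1" if deg: "mi_deg \<alpha> = 1" for \<alpha> :: "nat ^ 'a"
  proof -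
    obtain i where "\<alpha> $ i = 1" "\<forall>j. i \<noteq> j \<longrightarrow> \<alpha> $ j = 0"
      using deg sum_eq_1_iff[of UNIV "($) \<alpha>"] by (auto simp: mi_deg_def)
    then have "\<alpha> = axis i 1" by (auto simp: vec_eq_iff axis_def)
    then show ?thesis by blast
  qed
  moreover have "mi_deg (axis i 1 :: nat ^ 'a) = 1" for i
    by (simp add: mi_deg_def axis_def)
  ultimately show ?thesis by auto
qed

lemma sum_mi_upto_1:
  fixes g :: "nat ^ 'd \<Rightarrow> real"
  shows "(\<Sum>i=0..1. \<Sum>\<alpha> | mi_deg \<alpha> = i. g \<alpha>) = g 0 + (\<Sum>i\<in>UNIV. g (axis i 1))"
proof -
  have "inj (\<lambda>i. axis i 1 :: nat ^ 'd)" by (auto simp: inj_def axis_eq_axis)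
  then show ?thesis
    by (simp add: mi_deg_eq_0_iff mi_deg_eq_1[unfolded One_nat_def] sum.reindex)
qed

lemma mi_power_0: "mi_power s 0 = 1"
  by (simp add: mi_power_def)

lemma mi_power_axis: "mi_power s (axis i 1) = s $ i"
proof -
  have "mi_power s (axis i 1) = (\<Prod>j\<in>UNIV. if j = i then s $ j else 1)"
    unfolding mi_power_def by (rule prod.cong) (auto simp: axis_def)
  then show ?thesis by simp
qed

lemma exp_poly_density_1_iff:
  "exp_poly_density 1 S q \<longleftrightarrow>
     (\<exists>c0 c. q = exp_affine S c0 c) \<and> prob_space (density lborel (\<lambda>s. ennreal (q s)))"
proof -
  have *: "(\<Sum>i=0..1. \<Sum>\<alpha> | mi_deg \<alpha> = i. c \<alpha> * mi_power s \<alpha>) = c 0 + (\<chi> i. c (axis i 1)) \<bullet> s"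
    for c and s :: "real ^ 'a"
    by (simp only: sum_mi_upto_1 mi_power_0 mi_power_axis) (simp add: inner_vec_def)
  have ax: "axis i 1 \<noteq> (0 :: nat ^ 'a)" for i by (simp add: axis_eq_0_iff)
  have "(\<exists>c. q = (\<lambda>s. if s \<in> S then exp (\<Sum>i=0..1. \<Sum>\<alpha> | mi_deg \<alpha> = i. c \<alpha> * mi_power s \<alpha>) else 0)) \<longleftrightarrow>
     (\<exists>c0 c. q = exp_affine S c0 c)" (is "?L \<longleftrightarrow> ?R")
  proof
    assume ?L then show ?R unfolding * exp_affine_def[abs_def] by blast
  next
    assume ?R
    then obtain c0 c where q: "q = exp_affine S c0 c" by blast
    \<comment> \<open>Any extension of the coefficients to all multi-indices would do; this one
      takes the value \<open>c $ i\<close> at \<open>axis i 1\<close> without inverting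
      \<open>axis\<close>.\<close>
    define C where "C \<alpha> = (if \<alpha> = 0 then c0 else \<Sum>i\<in>UNIV. real (\<alpha> $ i) * c $ i)" for \<alpha> :: "nat ^ 'a"
    have "C (axis i 1) = c $ i" for i
    proof -
      have "C (axis i 1) = (\<Sum>j\<in>UNIV. if j = i then c $ j else 0)"
        unfolding C_def if_not_P[OF ax] by (intro sum.cong) (auto simp: axis_def)
      then show ?thesis by simp
    qed
    then have "C 0 = c0" "(\<chi> i. C (axis i 1)) = c" by (simp_all add: C_def vec_eq_iff)
    then show ?L unfolding * q exp_affine_def[abs_def] by (intro exI[of _ C]) (simp del: One_nat_def cong: if_cong)
  qed
  then show ?thesis unfolding exp_poly_density_def by simp
qed

section \<open>Expected log-likelihood and Gibbs' inequality\<close>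

text \<open>A hyperplane is a null set; for \<open>c = 0\<close> and \<open>b \<noteq> 0\<close> the
  exceptional set is empty. This degenerate case arises from two exponents that differ only in their
  constants.\<close>

lemma AE_inner_neq:
  fixes c :: "'a::euclidean_space"
  assumes "c \<noteq> 0 \<or> b \<noteq> 0"
  shows "AE s in lborel. c \<bullet> s \<noteq> b"
proof -
  have "negligible {s. c \<bullet> s = b}" using assms by (rule negligible_hyperplane)
  moreover have "{s. c \<bullet> s = b} \<in> sets lborel" by simp
  ultimately have "{s. c \<bullet> s = b} \<in> null_sets lborel"
    by (simp add: negligible_iff_null_sets null_sets_completion_iff)
  then show ?thesis by (rule AE_I') auto
qed

lemma prob_space_density_iff:
  assumes [measurable]: "q \<in> borel_measurable borel"
  shows "prob_space (density lborel (\<lambda>s. ennreal (q s))) \<longleftrightarrow> (\<integral>\<^sup>+ s. ennreal (q s) \<partial>lborel) = 1"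
proof -
  have "emeasure (density lborel (\<lambda>s. ennreal (q s))) (space (density lborel (\<lambda>s. ennreal (q s))))
      = (\<integral>\<^sup>+ s. ennreal (q s) \<partial>lborel)"
    by (simp add: emeasure_density)
  then show ?thesis using prob_spaceI prob_space.emeasure_space_1 by metis
qed

lemma nn_density_1_integral:
  assumes "q \<in> borel_measurable borel" "\<And>s. 0 \<le> q s" "(\<integral>\<^sup>+ s. ennreal (q s) \<partial>lborel) = 1"
  shows "has_bochner_integral lborel q 1"
  using assms by (intro has_bochner_integral_nn_integral) auto

lemma density_not_AE_0:
  assumes "(\<integral>\<^sup>+ s. ennreal (q s) \<partial>lborel) = 1" "AE s in lborel. q s = 0"
  shows False
proof -
  have "(\<integral>\<^sup>+ s. ennreal (q s) \<partial>lborel) = (\<integral>\<^sup>+ s. 0 \<partial>(lborel :: 'a measure))"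
    using assms(2) by (intro nn_integral_cong_AE) auto
  then show False using assms(1) by simp
qed

text \<open>The inner product with \<open>c\<close> is bounded and linear, so it passes through the
  vector-valued integral that defines \<open>mean\<close>.\<close>

lemma has_mean_affine:
  assumes "has_bochner_integral lborel q 1" "has_mean q"
  shows "has_bochner_integral lborel (\<lambda>s. q s * (c0 + c \<bullet> s)) (c0 + c \<bullet> mean q)"
proof -
  have "has_bochner_integral lborel (\<lambda>s. q s *\<^sub>R s) (mean q)"
    using assms(2) by (simp add: has_mean_def mean_def has_bochner_integral_iff)
  from has_bochner_integral_inner_right[OF this, of c]
  have "has_bochner_integral lborel (\<lambda>s. q s * (c \<bullet> s)) (c \<bullet> mean q)" by auto
  from has_bochner_integral_add[OF has_bochner_integral_mult_right[OF assms(1), of c0] this]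
  show ?thesis by (simp add: algebra_simps)
qed

text \<open>On \<open>S\<close> the logarithm cancels the exponential. Off \<open>S\<close> the
  factor \<open>p s\<close> vanishes almost everywhere, so the value of \<open>ln\<close> at 0 does
  not matter.\<close>

lemma exp_log_likelihood_exp_affine:
  assumes "has_bochner_integral lborel p 1" "has_mean p" "AE s in lborel. s \<notin> S \<longrightarrow> p s = 0"
    and [measurable]: "S \<in> sets borel"
  shows "exp_log_likelihood p (exp_affine S c0 c) = c0 + c \<bullet> mean p"
proof -
  have [measurable]: "p \<in> borel_measurable borel"
    using assms(1) by (auto simp: has_bochner_integral_iff)
  have "exp_log_likelihood p (exp_affine S c0 c) = (\<integral>s. p s * (c0 + c \<bullet> s) \<partial>lborel)"
    unfolding exp_log_likelihood_def
    by (rule integral_cong_AE) (use assms(3) in \<open>auto simp: exp_affine_def\<close>)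
  then show ?thesis
    using has_mean_affine[OF assms(1,2)] by (simp add: has_bochner_integral_iff)
qed

text \<open>Gibbs' inequality for the density \<open>q\<close>: pointwise \<open>q (e\<^sup>t - 1 - t) \<ge> 0\<close>, where \<open>t\<close> is the
  logarithm of the ratio of the two densities.\<close>

lemma exp_affine_Gibbs:
  fixes c d :: "real ^ 'd"
  assumes [measurable]: "S \<in> sets borel"
    and r: "(\<integral>\<^sup>+ s. ennreal (exp_affine S c0 c s) \<partial>lborel) = 1"
    and q: "(\<integral>\<^sup>+ s. ennreal (exp_affine S d0 d s) \<partial>lborel) = 1"
    and mean: "has_mean (exp_affine S d0 d)" "mean (exp_affine S d0 d) = z"
  shows "c0 + c \<bullet> z \<le> d0 + d \<bullet> z"
    and "c0 + c \<bullet> z = d0 + d \<bullet> z \<Longrightarrow> c0 = d0 \<and> c = d"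
proof -
  let ?q = "exp_affine S d0 d" and ?r = "exp_affine S c0 c"
  let ?t = "\<lambda>s. (c0 - d0) + (c - d) \<bullet> s"
  note ri = nn_density_1_integral[OF borel_measurable_exp_affine exp_affine_nonneg r]
  note qi = nn_density_1_integral[OF borel_measurable_exp_affine exp_affine_nonneg q]
  have "has_bochner_integral lborel (\<lambda>s. ?r s - ?q s - ?q s * ?t s) (1 - 1 - ((c0 - d0) + (c - d) \<bullet> z))"
    using has_bochner_integral_diff[OF has_bochner_integral_diff[OF ri qi] has_mean_affine[OF qi mean(1), of "c0 - d0" "c - d"]]
      mean(2) by simp
  \<comment> \<open>On \<open>S\<close> the quotient of \<open>?r\<close> and \<open>?q\<close> is
    \<open>exp (?t s)\<close>; off \<open>S\<close> both vanish.\<close>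
  moreover have eq: "?r s - ?q s - ?q s * ?t s = ?q s * (exp (?t s) - 1 - ?t s)" for s
    by (simp add: exp_affine_def algebra_simps exp_add[symmetric])
  ultimately have I: "has_bochner_integral lborel (\<lambda>s. ?q s * (exp (?t s) - 1 - ?t s)) ((d0 + d \<bullet> z) - (c0 + c \<bullet> z))"
    by (simp add: algebra_simps)
  have ge: "0 \<le> ?q s * (exp (?t s) - 1 - ?t s)" for s
    using exp_ge_add_one_self[of "?t s"] exp_affine_nonneg[of S d0 d s]
    by (intro mult_nonneg_nonneg) linarith+
  show "c0 + c \<bullet> z \<le> d0 + d \<bullet> z"
  proof -
    have "0 \<le> (\<integral>s. ?q s * (exp (?t s) - 1 - ?t s) \<partial>lborel)"
      by (intro Bochner_Integration.integral_nonneg ge)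
    then show ?thesis unfolding has_bochner_integral_integral_eq[OF I] by simp
  qed
  show "c0 = d0 \<and> c = d" if "c0 + c \<bullet> z = d0 + d \<bullet> z"
  proof (rule ccontr)
    assume ne: "\<not> (c0 = d0 \<and> c = d)"
    \<comment> \<open>In the equality case a nonnegative integrand has integral 0. The zero set of
      \<open>?t\<close> is a hyperplane or empty, so almost everywhere only the factor
      \<open>?q s\<close> can vanish.\<close>
    have "AE s in lborel. ?q s * (exp (?t s) - 1 - ?t s) = 0"
      using I that ge by (subst integral_nonneg_eq_0_iff_AE[symmetric]) (auto simp: has_bochner_integral_iff)
    moreover have "AE s in lborel. (c - d) \<bullet> s \<noteq> d0 - c0"
      by (rule AE_inner_neq) (use ne in auto)
    ultimately have "AE s in lborel. ?q s = 0"
    proof eventually_elim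
      case (elim s)
      then have "?t s \<noteq> 0" by auto
      \<comment> \<open>For positive \<open>x\<close>, \<open>ln x = x - 1\<close> forces
        \<open>x = 1\<close>; here \<open>x = exp (?t s)\<close>.\<close>
      then have "exp (?t s) - 1 - ?t s \<noteq> 0" using ln_eq_minus_one[of "exp (?t s)"] by fastforce
      then show ?case using elim(1) by auto
    qed
    then show False using density_not_AE_0[OF q] by blast
  qed
qed

section \<open>One-dimensional marginals on half-lines and intervals\<close>

text \<open>With \<open>r = 1 / (z - a)\<close> this is the exponential distribution of rate
  \<open>r\<close> shifted to start at \<open>a\<close>, whose mean is
  \<open>a + 1 / r = z\<close>.\<close>

lemma has_bochner_integral_exp_atLeast:
  fixes a z :: real
  assumes "a < z"
  defines "g \<equiv> \<lambda>t. if a \<le> t then exp (inverse (a - z) * t + (- ln (z - a) + a / (z - a))) else 0"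
  shows "has_bochner_integral lborel g 1" "has_bochner_integral lborel (\<lambda>t. t * g t) z"
proof -
  define r where "r = inverse (z - a)"
  have r: "0 < r" "z - a = 1 / r" using assms by (auto simp: r_def field_simps)
  have g: "g t = (if a \<le> t then r * exp (- r * (t - a)) else 0)" for t
  proof -
    have "inverse (a - z) * t + (- ln (z - a) + a / (z - a)) = ln r + (- r * (t - a))"
    proof -
      have "inverse (a - z) = - r" unfolding r_def by (metis inverse_minus_eq minus_diff_eq)
      moreover have "- ln (z - a) = ln r" using assms by (simp add: r_def ln_inverse)
      moreover have "a / (z - a) = a * r" by (simp add: r_def divide_inverse)
      ultimately show ?thesis by (simp add: algebra_simps)
    qed
    then show ?thesis using r(1) by (simp add: g_def exp_diff exp_minus divide_inverse)
  qed
  have "(\<integral>\<^sup>+ t. ennreal (r * exp (- r * (t - a))) * indicator {a..} t \<partial>lborel)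
      = ennreal (0 - (- exp (- r * (a - a))))"
  proof (rule nn_integral_FTC_atLeast[where F="\<lambda>t. - exp (- r * (t - a))"])
    show "((\<lambda>t. - exp (- r * (t - a))) \<longlongrightarrow> 0) at_top" using r(1) by real_asymp
  qed (use r(1) in \<open>auto intro!: derivative_eq_intros\<close>)
  moreover have "(\<lambda>t. ennreal (r * exp (- r * (t - a))) * indicator {a..} t) = (\<lambda>t. ennreal (g t))"
    by (auto simp: g indicator_def)
  ultimately show 1: "has_bochner_integral lborel g 1"
    using r(1) by (intro has_bochner_integral_nn_integral) (auto simp: g[abs_def])
  \<comment> \<open>The first moment is taken about \<open>a\<close>, where the integrand is
    nonnegative, and \<open>a\<close> times the total mass is added afterwards. The primitive comes
    from integration by parts.\<close>
  have "(\<integral>\<^sup>+ t. ennreal ((t - a) * (r * exp (- r * (t - a)))) * indicator {a..} t \<partial>lborel)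
      = ennreal (0 - (- ((a - a) + 1 / r) * exp (- r * (a - a))))"
  proof (rule nn_integral_FTC_atLeast[where F="\<lambda>t. - ((t - a) + 1 / r) * exp (- r * (t - a))"])
    show "((\<lambda>t. - ((t - a) + 1 / r) * exp (- r * (t - a))) \<longlongrightarrow> 0) at_top" using r(1) by real_asymp
  qed (use r(1) in \<open>auto intro!: derivative_eq_intros simp: field_simps\<close>)
  moreover have "(\<lambda>t. ennreal ((t - a) * (r * exp (- r * (t - a)))) * indicator {a..} t) = (\<lambda>t. ennreal ((t - a) * g t))"
    by (auto simp: g indicator_def)
  ultimately have "has_bochner_integral lborel (\<lambda>t. (t - a) * g t) (z - a)"
    using r by (intro has_bochner_integral_nn_integral) (auto simp: g[abs_def])
  from has_bochner_integral_add[OF this has_bochner_integral_mult_right[OF 1, of a]]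
  show "has_bochner_integral lborel (\<lambda>t. t * g t) z" by (simp add: algebra_simps)
qed

text \<open>The reflection of \<open>t\<close> to \<open>- t\<close> reduces this to the half-line
  starting at \<open>- b\<close>, with mean \<open>- z\<close>.\<close>

lemma has_bochner_integral_exp_atMost:
  fixes b z :: real
  assumes "z < b"
  defines "g \<equiv> \<lambda>t. if t \<le> b then exp (inverse (b - z) * t + (- ln (b - z) + b / (z - b))) else 0"
  shows "has_bochner_integral lborel g 1" "has_bochner_integral lborel (\<lambda>t. t * g t) z"
proof -
  \<comment> \<open>Spelled out as the literal instance of the half-line density with
    \<open>- b\<close> for \<open>a\<close> and \<open>- z\<close> for \<open>z\<close>, so that it
    can be folded.\<close>
  define g' where "g' t = (if - b \<le> t then exp (inverse (- b - (- z)) * t + (- ln (- z - (- b)) + (- b) / (- z - (- b)))) else 0)" for t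
  have refl: "g' (- t) = g t" for t
  proof -
    have "inverse (- b - (- z)) = - inverse (b - z)" by (metis inverse_minus_eq minus_diff_eq minus_diff_minus)
    moreover have "(- b) / (- z - (- b)) = b / (z - b)" by (metis minus_diff_eq minus_diff_minus minus_divide_left minus_divide_right minus_minus)
    ultimately show ?thesis unfolding g_def g'_def by simp
  qed
  have "- b < - z" using assms by simp
  note * = has_bochner_integral_exp_atLeast[OF this, folded g'_def]
  show "has_bochner_integral lborel g 1"
    using *(1)[THEN iffD1[OF lborel_has_bochner_integral_real_affine_iff[of "-1" _ _ 0], rotated]]
    by (simp add: refl)
  have "has_bochner_integral lborel (\<lambda>t. - (t * g t)) (- z)"
    using *(2)[THEN iffD1[OF lborel_has_bochner_integral_real_affine_iff[of "-1" _ _ 0], rotated]]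
    by (simp add: refl)
  from has_bochner_integral_minus[OF this]
  show "has_bochner_integral lborel (\<lambda>t. t * g t) z" by simp
qed

text \<open>This is a truncated exponential. Its mean is \<open>z\<close> exactly if the root
  equation holds: multiply the mean condition by \<open>l * D\<close> and divide by
  \<open>exp (a * l)\<close>. Since \<open>l = 0\<close> solves that equation for every
  \<open>z\<close>, a root must be nonzero to carry information.\<close>

lemma has_bochner_integral_exp_Icc:
  fixes a b z l :: real
  assumes "a < b" and root: "nonzero_root a b z l"
  defines "g \<equiv> \<lambda>t. if a \<le> t \<and> t \<le> b then exp (l * t + ln (l / (exp (b * l) - exp (a * l)))) else 0"
  shows "has_bochner_integral lborel g 1" "has_bochner_integral lborel (\<lambda>t. t * g t) z"
proof -
  define D where "D = exp (b * l) - exp (a * l)"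
  have l: "l \<noteq> 0" and eq: "((b - z) * l - 1) * exp ((b - a) * l) - (a - z) * l + 1 = 0"
    using root by (auto simp: nonzero_root_def)
  \<comment> \<open>The denominator \<open>D\<close> has the sign of \<open>l\<close>, so the
    logarithm in the normalising constant is applied to a positive number.\<close>
  have pos: "0 < l / D"
  proof (cases "0 < l")
    case True then show ?thesis using assms(1) by (simp add: D_def)
  next
    case False
    then have "l < 0" using l by simp
    then have "D < 0" using assms(1) by (simp add: D_def)
    then show ?thesis using \<open>l < 0\<close> by (simp add: zero_less_divide_iff)
  qed
  have D: "D \<noteq> 0" using pos by auto
  have g: "g t = (l / D * exp (l * t)) * indicator {a..b} t" for t
    using pos by (auto simp: g_def D_def[symmetric] exp_add indicator_def)
  have "has_bochner_integral lborel (\<lambda>t. (l / D * exp (l * t)) * indicator {a..b} t) (exp (l * b) / D - exp (l * a) / D)"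
    using assms(1) by (intro has_bochner_integral_FTC_Icc_real[where F="\<lambda>t. exp (l * t) / D"])
      (auto intro!: derivative_eq_intros continuous_intros simp: D)
  moreover have "exp (l * b) / D - exp (l * a) / D = 1"
    using D by (simp add: diff_divide_distrib[symmetric]) (simp add: D_def mult.commute)
  ultimately show "has_bochner_integral lborel g 1" by (simp add: g[abs_def])
  have "has_bochner_integral lborel (\<lambda>t. (t * (l / D * exp (l * t))) * indicator {a..b} t)
     ((b - 1 / l) * exp (l * b) / D - (a - 1 / l) * exp (l * a) / D)"
    using assms(1) l by (intro has_bochner_integral_FTC_Icc_real[where F="\<lambda>t. (t - 1 / l) * exp (l * t) / D"])
      (auto intro!: derivative_eq_intros continuous_intros simp: D field_simps)
  moreover have "(b - 1 / l) * exp (l * b) / D - (a - 1 / l) * exp (l * a) / D = z"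
  proof -
    \<comment> \<open>Multiplying the root equation by \<open>exp (l * a)\<close> makes it symmetric
      in the two end points.\<close>
    have "exp (l * b) = exp (l * a) * exp ((b - a) * l)" by (simp add: exp_add[symmetric] algebra_simps)
    then have "((b - z) * l - 1) * exp (l * b) + (1 - (a - z) * l) * exp (l * a)
        = exp (l * a) * (((b - z) * l - 1) * exp ((b - a) * l) - (a - z) * l + 1)"
      by (simp add: algebra_simps)
    then have "((b - z) * l - 1) * exp (l * b) + (1 - (a - z) * l) * exp (l * a) = 0"
      unfolding eq by simp
    then have "(b * l - 1) * exp (l * b) - (a * l - 1) * exp (l * a) = z * (l * D)"
      by (simp add: D_def algebra_simps)
    moreover have "(b - 1 / l) * exp (l * b) / D - (a - 1 / l) * exp (l * a) / D
       = ((b * l - 1) * exp (l * b) - (a * l - 1) * exp (l * a)) / (l * D)"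
      using l D by (simp add: field_simps)
    ultimately show ?thesis using l D by simp
  qed
  ultimately show "has_bochner_integral lborel (\<lambda>t. t * g t) z" by (simp add: g[abs_def] mult.assoc)
qed

text \<open>The cases are those of \<open>lambda1\<close> and \<open>lambda0\<close>. The whole line
  is excluded by \<open>finite\<close>, and the bounds \<open>lo = \<infinity>\<close> and
  \<open>up = - \<infinity>\<close> by \<open>z\<close>.\<close>

lemma has_bochner_integral_exp_marginal:
  fixes lo up :: ereal and z r :: real
  assumes finite: "\<bar>lo\<bar> \<noteq> \<infinity> \<or> \<bar>up\<bar> \<noteq> \<infinity>" and z: "lo < ereal z" "ereal z < up"
    and root: "\<bar>lo\<bar> \<noteq> \<infinity> \<and> \<bar>up\<bar> \<noteq> \<infinity> \<longrightarrow> nonzero_root (real_of_ereal lo) (real_of_ereal up) z r"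
  defines "g \<equiv> \<lambda>t. if lo \<le> ereal t \<and> ereal t \<le> up then exp (lambda1 lo up z r * t + lambda0 lo up z r) else 0"
  shows "has_bochner_integral lborel g 1 \<and> has_bochner_integral lborel (\<lambda>t. t * g t) z"
proof (cases lo; cases up)
  fix a assume [simp]: "lo = ereal a" "up = \<infinity>"
  then show ?thesis using has_bochner_integral_exp_atLeast[of a z] z
    by (simp add: g_def lambda1_def lambda0_def cong: if_cong)
next
  fix b assume [simp]: "lo = - \<infinity>" "up = ereal b"
  then show ?thesis using has_bochner_integral_exp_atMost[of z b] z
    by (simp add: g_def lambda1_def lambda0_def cong: if_cong)
next
  fix a b assume [simp]: "lo = ereal a" "up = ereal b"
  then show ?thesis using has_bochner_integral_exp_Icc[of a b z r] z root
    by (simp add: g_def lambda1_def lambda0_def cong: if_cong)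
qed (use finite z in auto)

section \<open>Product densities\<close>

text \<open>Fubini for product integrands, carried from basis vectors to indices along the bijection
  that sends \<open>i\<close> to \<open>axis i 1\<close>.\<close>

lemma nn_integral_lborel_vec_prod:
  fixes f :: "'d::finite \<Rightarrow> real \<Rightarrow> ennreal"
  assumes "\<And>i. f i \<in> borel_measurable borel"
  shows "(\<integral>\<^sup>+ s. (\<Prod>i\<in>UNIV. f i (s $ i)) \<partial>(lborel :: (real ^ 'd) measure)) = (\<Prod>i\<in>UNIV. \<integral>\<^sup>+ t. f i t \<partial>lborel)"
proof -
  have B: "(Basis :: (real ^ 'd) set) = range (\<lambda>i. axis i 1)" by (auto simp: Basis_vec_def)
  have inj: "inj (\<lambda>i::'d. axis i 1 :: real ^ 'd)" by (auto simp: inj_def axis_eq_axis)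
  let ?ix = "the_inv (\<lambda>i::'d. axis i 1 :: real ^ 'd)"
  have "(\<integral>\<^sup>+ s. (\<Prod>b\<in>Basis. f (?ix b) (s \<bullet> b)) \<partial>(lborel :: (real ^ 'd) measure))
      = (\<Prod>b\<in>(Basis :: (real ^ 'd) set). \<integral>\<^sup>+ t. f (?ix b) t \<partial>lborel)"
    by (rule nn_integral_lborel_prod) (use assms in auto)
  then show ?thesis
    unfolding B by (simp add: prod.reindex[OF inj] the_inv_f_f[OF inj] cart_eq_inner_axis)
qed

text \<open>All factors have mass 1, so a weight that depends on coordinate \<open>i\<close> alone
  sees only the factor \<open>g i\<close>.\<close>

lemma has_bochner_integral_prod_vec:
  fixes g :: "'d::finite \<Rightarrow> real \<Rightarrow> real" and z :: "real ^ 'd"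
  assumes nonneg: "\<And>i t. 0 \<le> g i t"
    and one: "\<And>i. has_bochner_integral lborel (g i) 1"
    and mean: "\<And>i. has_bochner_integral lborel (\<lambda>t. t * g i t) (z $ i)"
  defines "q \<equiv> \<lambda>s :: real ^ 'd. \<Prod>i\<in>UNIV. g i (s $ i)"
  shows "(\<integral>\<^sup>+ s. ennreal (q s) \<partial>lborel) = 1"
    and "has_bochner_integral lborel (\<lambda>s. q s *\<^sub>R s) z"
proof -
  have meas[measurable]: "g i \<in> borel_measurable borel" for i
    using one[of i] by (auto simp: has_bochner_integral_iff)
  have nn1: "(\<integral>\<^sup>+ t. ennreal (g i t) \<partial>lborel) = 1" for i
    using has_bochner_integral_iff nn_integral_eq_integral nonneg one by (metis AE_I2 ennreal_1)
  show "(\<integral>\<^sup>+ s. ennreal (q s) \<partial>lborel) = 1"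
    unfolding q_def using nonneg nn1
    by (simp add: prod_ennreal[symmetric] nn_integral_lborel_vec_prod[of "\<lambda>i t. ennreal (g i t)"])
  have weighted: "has_bochner_integral lborel (\<lambda>s. h (s $ i) * q s) (\<integral>t. h t * g i t \<partial>lborel)"
    if h: "\<And>t. 0 \<le> h t" and int: "integrable lborel (\<lambda>t. h t * g i t)"
      and [measurable]: "h \<in> borel_measurable borel" for h i
  proof -
    have nn: "0 \<le> h t * g i t" for t using h nonneg by simp
    \<comment> \<open>The weight is absorbed into the factor of index \<open>i\<close>, which makes
      the integrand a product over the coordinates again.\<close>
    have split: "h (s $ i) * q s = (\<Prod>j\<in>UNIV. if j = i then h (s $ i) * g i (s $ i) else g j (s $ j))" for s
      unfolding q_def by (simp add: prod.remove[of UNIV i] mult.assoc)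
    have "(\<integral>\<^sup>+ s. ennreal (h (s $ i) * q s) \<partial>lborel)
        = (\<integral>\<^sup>+ s. (\<Prod>j\<in>UNIV. ennreal (if j = i then h (s $ j) * g i (s $ j) else g j (s $ j))) \<partial>(lborel :: (real ^ 'd) measure))"
      unfolding split using nn nonneg by (subst prod_ennreal) (auto intro!: nn_integral_cong prod.cong arg_cong[where f=ennreal])
    also have "\<dots> = (\<Prod>j\<in>UNIV. \<integral>\<^sup>+ t. ennreal (if j = i then h t * g i t else g j t) \<partial>lborel)"
      by (rule nn_integral_lborel_vec_prod[where f="\<lambda>j t. ennreal (if j = i then h t * g i t else g j t)"]) auto
    also have "\<dots> = (\<integral>\<^sup>+ t. ennreal (h t * g i t) \<partial>lborel)"
      using nn1 by (simp add: prod.remove[of UNIV i])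
    also have "\<dots> = ennreal (\<integral>t. h t * g i t \<partial>lborel)"
      using nn int by (intro nn_integral_eq_integral) auto
    finally show ?thesis
      using h nonneg nn by (intro has_bochner_integral_nn_integral)
        (auto simp: q_def intro!: prod_nonneg mult_nonneg_nonneg Bochner_Integration.integral_nonneg)
  qed
  \<comment> \<open>The product formula holds for nonnegative integrands, hence the split of \<open>t\<close> into its positive
    and negative parts.\<close>
  have comp: "has_bochner_integral lborel (\<lambda>s. s $ i * q s) (z $ i)" for i
  proof -
    have int: "integrable lborel (\<lambda>t. t * g i t)" using mean by (auto simp: has_bochner_integral_iff)
    have p: "integrable lborel (\<lambda>t. max 0 t * g i t)" and m: "integrable lborel (\<lambda>t. max 0 (- t) * g i t)"
      by (rule Bochner_Integration.integrable_bound[OF int]; use nonneg in \<open>auto intro!: mult_right_mono simp: abs_mult\<close>)+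
    have "has_bochner_integral lborel (\<lambda>s. max 0 (s $ i) * q s - max 0 (- s $ i) * q s)
       ((\<integral>t. max 0 t * g i t \<partial>lborel) - (\<integral>t. max 0 (- t) * g i t \<partial>lborel))"
      by (intro has_bochner_integral_diff weighted[OF _ p] weighted[OF _ m]) auto
    moreover have "max 0 t * c - max 0 (- t) * c = t * c" for t c :: real
      by (simp add: max_def)
    moreover have "(\<integral>t. max 0 t * g i t \<partial>lborel) - (\<integral>t. max 0 (- t) * g i t \<partial>lborel) = z $ i"
      using mean[of i] calculation(2) unfolding Bochner_Integration.integral_diff[OF p m, symmetric]
      by (simp add: has_bochner_integral_iff)
    ultimately show ?thesis by simp
  qed
  \<comment> \<open>The vector-valued integral is assembled from its coordinates along the standard
    basis.\<close>
  have "has_bochner_integral lborel (\<lambda>s. \<Sum>i\<in>UNIV. (s $ i * q s) *\<^sub>R axis i (1 :: real)) (\<Sum>i\<in>UNIV. (z $ i) *\<^sub>R axis i 1)"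
    by (intro has_bochner_integral_sum has_bochner_integral_scaleR_left) (use comp in auto)
  moreover have "(\<Sum>i\<in>UNIV. (s $ i * c) *\<^sub>R axis i 1) = c *\<^sub>R s" for s :: "real ^ 'd" and c
    by (auto simp: vec_eq_iff axis_def if_distrib[of "\<lambda>x. _ * x"] cong: if_cong)
  ultimately show "has_bochner_integral lborel (\<lambda>s. q s *\<^sub>R s) z"
    by (metis (no_types, lifting) ext mult.right_neutral scaleR_one)
qed

section \<open>Position of the mean in the box\<close>

lemma closed_ebox: "closed (ebox lo up)"
proof -
  have "ebox lo up = (\<Inter>i. {c. lo $ i \<le> ereal (c $ i)} \<inter> {c. ereal (c $ i) \<le> up $ i})"
    by (auto simp: ebox_def)
  also have "closed \<dots>"
    by (intro closed_INT ballI closed_Int closed_Collect_le continuous_intros)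
  finally show ?thesis .
qed

text \<open>An affine function that is nonnegative on the box has nonnegative expectation.
  Expectation 0 would concentrate \<open>p\<close> on a hyperplane, which is a null set. Strictness
  keeps the logarithms and quotients in \<open>lambda0\<close> and \<open>lambda1\<close>
  meaningful.\<close>

lemma mean_in_ebox_interior:
  fixes p :: "real ^ 'd \<Rightarrow> real"
  assumes nonneg: "\<And>s. 0 \<le> p s" and p: "has_bochner_integral lborel p 1" and mean: "has_mean p"
    and supp: "AE s in lborel. s \<notin> ebox lo up \<longrightarrow> p s = 0"
  shows "lo $ i < ereal (mean p $ i)" and "ereal (mean p $ i) < up $ i"
proof -
  have notzero: False if "AE s in lborel. p s = 0"
    using integral_cong_AE[of p lborel "\<lambda>_. 0"] that p by (auto simp: has_bochner_integral_iff)
  \<comment> \<open>The box has a point because \<open>p\<close> is not almost everywhere 0. This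
    point rules out \<open>lo $ i = \<infinity>\<close> and \<open>up $ i = - \<infinity>\<close>
    below.\<close>
  obtain s where "s \<in> ebox lo up"
  proof (rule ccontr)
    assume "\<not> thesis"
    then have "AE s in lborel. p s = 0" using supp that by auto
    then show False by (rule notzero)
  qed
  then have s: "lo $ i \<le> ereal (s $ i)" "ereal (s $ i) \<le> up $ i" by (auto simp: ebox_def)
  have pos: "0 < c0 + c \<bullet> mean p"
    if c: "c \<noteq> 0" and ge: "\<And>s. s \<in> ebox lo up \<Longrightarrow> 0 \<le> c0 + c \<bullet> s" for c0 c
  proof -
    have I: "has_bochner_integral lborel (\<lambda>s. p s * (c0 + c \<bullet> s)) (c0 + c \<bullet> mean p)"
      by (rule has_mean_affine[OF p mean])
    have nn: "AE s in lborel. 0 \<le> p s * (c0 + c \<bullet> s)"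
      using supp by eventually_elim (use nonneg ge in fastforce)
    have "0 \<le> c0 + c \<bullet> mean p"
      using integral_nonneg_AE[OF nn] I by (simp add: has_bochner_integral_iff)
    moreover have "c0 + c \<bullet> mean p \<noteq> 0"
    proof
      assume "c0 + c \<bullet> mean p = 0"
      then have "AE s in lborel. p s * (c0 + c \<bullet> s) = 0"
        using integral_nonneg_eq_0_iff_AE[OF _ nn] I by (simp add: has_bochner_integral_iff)
      moreover have "AE s in lborel. c \<bullet> s \<noteq> - c0" using c by (intro AE_inner_neq) simp
      ultimately have "AE s in lborel. p s = 0" by eventually_elim auto
      then show False by (rule notzero)
    qed
    ultimately show ?thesis by simp
  qed
  \<comment> \<open>The affine functions used are \<open>s $ i - a\<close> and
    \<open>b - s $ i\<close>, with gradients \<open>axis i 1\<close> and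
    \<open>- axis i 1\<close>.\<close>
  have ax: "axis i (1 :: real) \<noteq> 0" by (simp add: axis_eq_0_iff)
  show "lo $ i < ereal (mean p $ i)"
  proof (cases "lo $ i")
    case (real a)
    then have "a \<le> s $ i" if "s \<in> ebox lo up" for s
      using that by (metis (mono_tags) ebox_def ereal_less_eq(3) mem_Collect_eq)
    then show ?thesis using pos[OF ax, of "- a"] real by (simp add: inner_axis')
  qed (use s in auto)
  show "ereal (mean p $ i) < up $ i"
  proof (cases "up $ i")
    case (real b)
    then have "s $ i \<le> b" if "s \<in> ebox lo up" for s
      using that by (metis (mono_tags) ebox_def ereal_less_eq(3) mem_Collect_eq)
    then show ?thesis using pos[of "- axis i 1" b] ax real by (simp add: inner_axis')
  qed (use s in auto)
qed

section \<open>Optimality and uniqueness of the claimed density\<close>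

lemma robust_exp_density_eq_exp_affine:
  "robust_exp_density S lo up z xs =
     exp_affine S (\<Sum>i\<in>UNIV. lambda0 (lo $ i) (up $ i) (z $ i) (xs $ i))
       (\<chi> i. lambda1 (lo $ i) (up $ i) (z $ i) (xs $ i))"
  by (rule ext) (simp add: robust_exp_density_def exp_affine_def exp_sum[symmetric] inner_vec_def
      sum.distrib add.commute)

text \<open>The box is a product of intervals, so the density factors into its marginals together
  with its cutoff: outside the box at least one factor is 0.\<close>

lemma robust_exp_density_mean:
  fixes lo up :: "ereal ^ 'd" and z xs :: "real ^ 'd"
  assumes finite: "\<And>i. \<bar>lo $ i\<bar> \<noteq> \<infinity> \<or> \<bar>up $ i\<bar> \<noteq> \<infinity>"
    and z: "\<And>i. lo $ i < ereal (z $ i)" "\<And>i. ereal (z $ i) < up $ i"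
    and root: "\<And>i. \<bar>lo $ i\<bar> \<noteq> \<infinity> \<and> \<bar>up $ i\<bar> \<noteq> \<infinity> \<Longrightarrow>
        nonzero_root (real_of_ereal (lo $ i)) (real_of_ereal (up $ i)) (z $ i) (xs $ i)"
  defines "q \<equiv> robust_exp_density (ebox lo up) lo up z xs"
  shows "(\<integral>\<^sup>+ s. ennreal (q s) \<partial>lborel) = 1" "has_mean q" "mean q = z"
proof -
  define g where "g i t = (if lo $ i \<le> ereal t \<and> ereal t \<le> up $ i
    then exp (lambda1 (lo $ i) (up $ i) (z $ i) (xs $ i) * t + lambda0 (lo $ i) (up $ i) (z $ i) (xs $ i)) else 0)" for i t
  have "has_bochner_integral lborel (g i) 1 \<and> has_bochner_integral lborel (\<lambda>t. t * g i t) (z $ i)" for i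
    unfolding g_def[abs_def] by (intro has_bochner_integral_exp_marginal finite z impI root)
  moreover have "0 \<le> g i t" for i t by (simp add: g_def)
  moreover have q: "q = (\<lambda>s. \<Prod>i\<in>UNIV. g i (s $ i))"
  proof
    fix s
    show "q s = (\<Prod>i\<in>UNIV. g i (s $ i))"
    proof (cases "s \<in> ebox lo up")
      case True
      then show ?thesis unfolding q_def robust_exp_density_def g_def
        by (auto simp: ebox_def intro!: prod.cong)
    next
      case False
      then have "\<exists>i. g i (s $ i) = 0" by (auto simp: ebox_def g_def)
      then have "(\<Prod>i\<in>UNIV. g i (s $ i)) = 0" by (intro prod_zero) auto
      then show ?thesis using False by (simp add: q_def robust_exp_density_def)
    qed
  qed
  ultimately have "(\<integral>\<^sup>+ s. ennreal (q s) \<partial>lborel) = 1" "has_bochner_integral lborel (\<lambda>s. q s *\<^sub>R s) z"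
    unfolding q using has_bochner_integral_prod_vec[of g z] by blast+
  then show "(\<integral>\<^sup>+ s. ennreal (q s) \<partial>lborel) = 1" "has_mean q" "mean q = z"
    by (auto simp: has_mean_def mean_def has_bochner_integral_iff)
qed

text \<open>Expected log-likelihoods under \<open>p\<close> are values of affine exponents at
  \<open>mean p\<close>, which is also the mean of \<open>?q\<close>. These are the values that
  Gibbs' inequality for \<open>?q\<close> compares.\<close>

lemma optimal_iff_robust_exp_density:
  fixes p :: "real ^ 'd \<Rightarrow> real"
  assumes nonneg: "\<And>s. 0 \<le> p s" and meas: "p \<in> borel_measurable borel"
    and one: "(\<integral>\<^sup>+ s. ennreal (p s) \<partial>lborel) = 1"
    and supp: "AE s in lborel. s \<notin> ebox lo up \<longrightarrow> p s = 0"
    and mean: "has_mean p"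
    and finite: "\<And>i. \<bar>lo $ i\<bar> \<noteq> \<infinity> \<or> \<bar>up $ i\<bar> \<noteq> \<infinity>"
    and root: "\<And>i. \<bar>lo $ i\<bar> \<noteq> \<infinity> \<and> \<bar>up $ i\<bar> \<noteq> \<infinity> \<Longrightarrow>
        nonzero_root (real_of_ereal (lo $ i)) (real_of_ereal (up $ i)) (mean p $ i) (xs $ i)"
  shows "exp_poly_density 1 (ebox lo up) F \<and>
      (\<forall>q. exp_poly_density 1 (ebox lo up) q \<longrightarrow> exp_log_likelihood p q \<le> exp_log_likelihood p F)
    \<longleftrightarrow> F = robust_exp_density (ebox lo up) lo up (mean p) xs"
    (is "?opt \<longleftrightarrow> F = ?q")
proof -
  let ?S = "ebox lo up" and ?z = "mean p"
  have S[measurable]: "?S \<in> sets borel" using closed_ebox by (rule borel_closed)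
  have p: "has_bochner_integral lborel p 1" by (rule nn_density_1_integral) fact+
  note z = mean_in_ebox_interior[OF nonneg p mean supp]
  obtain d0 d where q: "?q = exp_affine ?S d0 d" using robust_exp_density_eq_exp_affine by blast
  note q1 = robust_exp_density_mean[OF finite z root, unfolded q]
  note ell = exp_log_likelihood_exp_affine[OF p mean supp S]
  have density: "exp_poly_density 1 ?S r \<longleftrightarrow>
      (\<exists>c0 c. r = exp_affine ?S c0 c \<and> (\<integral>\<^sup>+ s. ennreal (exp_affine ?S c0 c s) \<partial>lborel) = 1)" for r
    unfolding exp_poly_density_1_iff using prob_space_density_iff[OF borel_measurable_exp_affine[OF S]] by auto
  show ?thesis
  proof
    assume "F = ?q"
    then show ?opt
      unfolding q density using q1(1) exp_affine_Gibbs(1)[OF S _ q1] by (auto simp: ell)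
  next
    assume opt: ?opt
    then obtain c0 c where F: "F = exp_affine ?S c0 c" "(\<integral>\<^sup>+ s. ennreal (exp_affine ?S c0 c s) \<partial>lborel) = 1"
      unfolding density by blast
    \<comment> \<open>Testing an optimal \<open>F\<close> against \<open>?q\<close> gives the
      reverse of Gibbs' inequality, and the equality case identifies the coefficients.\<close>
    have "exp_log_likelihood p (exp_affine ?S d0 d) \<le> exp_log_likelihood p F"
      using opt q1(1) density by blast
    then have "d0 + d \<bullet> ?z \<le> c0 + c \<bullet> ?z" by (simp add: F(1) ell)
    then have "c0 = d0 \<and> c = d"
      using exp_affine_Gibbs[OF S F(2) q1] by linarith
    then show "F = ?q" by (simp add: F q)
  qed
qed

text \<open>In almost every history the section of the conditional density is a probability density
  that vanishes almost everywhere off the box; for such a history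
  \<open>optimal_iff_robust_exp_density\<close> applies.\<close>

theorem theorem5:
  fixes M :: "'a measure" and n :: nat
    and f :: "real ^ 'dx \<Rightarrow> real ^ 'du \<Rightarrow> real ^ 'dx"
    and h :: "real ^ 'dx \<Rightarrow> real ^ 'dy"
    and x w :: "nat \<Rightarrow> 'a \<Rightarrow> real ^ 'dx"
    and u :: "nat \<Rightarrow> 'a \<Rightarrow> real ^ 'du"
    and v y :: "nat \<Rightarrow> 'a \<Rightarrow> real ^ 'dy"
    and lo up :: "nat \<Rightarrow> ereal ^ 'dy"
    and p :: "nat \<Rightarrow> (nat \<Rightarrow> real ^ 'dy) \<Rightarrow> real ^ 'dy \<Rightarrow> real"
  assumes system: "stochastic_system M n f h x u w v y"
    and info: "moment_info 1 M n w v u (x 0)"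
    and cond_dens: "\<And>k. k \<in> {1..n} \<Longrightarrow> cond_density M y k (p k)"
    and supp: "\<And>k. k \<in> {1..n} \<Longrightarrow> rv_support M (y k) = ebox (lo k) (up k)"
    and one_finite: "\<And>k i. k \<in> {1..n} \<Longrightarrow> \<bar>lo k $ i\<bar> \<noteq> \<infinity> \<or> \<bar>up k $ i\<bar> \<noteq> \<infinity>"
  shows "\<forall>k\<in>{1..n}. AE ys in history_law M y k. has_mean (p k ys) \<longrightarrow>
    (\<forall>z xs. z = mean (p k ys) \<longrightarrow>
      (\<forall>i. \<bar>lo k $ i\<bar> \<noteq> \<infinity> \<and> \<bar>up k $ i\<bar> \<noteq> \<infinity> \<longrightarrow>
        nonzero_root (real_of_ereal (lo k $ i)) (real_of_ereal (up k $ i)) (z $ i) (xs $ i)) \<longrightarrow>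
      (\<forall>F. optimal_robust_predictor_at 1 M y (p k ys) F k ys \<longleftrightarrow>
        F k ys = robust_exp_density (rv_support M (y k)) (lo k) (up k) z xs))"
proof
  fix k assume k: "k \<in> {1..n}"
  have "prob_space M" using system by (rule stochastic_system.axioms(1))
  moreover have "rv_support M (y k) \<in> sets borel"
    unfolding supp[OF k] by (rule borel_closed[OF closed_ebox])
  ultimately have "AE ys in history_law M y k. p k ys \<in> borel_measurable borel \<and>
      (\<integral>\<^sup>+ s. ennreal (p k ys s) \<partial>lborel) = 1 \<and> (AE s in lborel. s \<notin> rv_support M (y k) \<longrightarrow> p k ys s = 0)"
    by (intro AE_cond_density cond_dens k)
  moreover have nonneg: "0 \<le> p k ys s" for ys s using cond_dens[OF k] by (auto simp: cond_density_def)
  ultimately show "AE ys in history_law M y k. has_mean (p k ys) \<longrightarrow>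
    (\<forall>z xs. z = mean (p k ys) \<longrightarrow>
      (\<forall>i. \<bar>lo k $ i\<bar> \<noteq> \<infinity> \<and> \<bar>up k $ i\<bar> \<noteq> \<infinity> \<longrightarrow>
        nonzero_root (real_of_ereal (lo k $ i)) (real_of_ereal (up k $ i)) (z $ i) (xs $ i)) \<longrightarrow>
      (\<forall>F. optimal_robust_predictor_at 1 M y (p k ys) F k ys \<longleftrightarrow>
        F k ys = robust_exp_density (rv_support M (y k)) (lo k) (up k) z xs))"
    unfolding supp[OF k] optimal_robust_predictor_at_def robust_predictor_at_def
  proof (eventually_elim, intro impI allI)
    fix ys z xs F
    assume "p k ys \<in> borel_measurable borel \<and> (\<integral>\<^sup>+ s. ennreal (p k ys s) \<partial>lborel) = 1 \<and>
        (AE s in lborel. s \<notin> ebox (lo k) (up k) \<longrightarrow> p k ys s = 0)"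
      and "has_mean (p k ys)" and z: "z = mean (p k ys)"
      and "\<forall>i. \<bar>lo k $ i\<bar> \<noteq> \<infinity> \<and> \<bar>up k $ i\<bar> \<noteq> \<infinity> \<longrightarrow>
        nonzero_root (real_of_ereal (lo k $ i)) (real_of_ereal (up k $ i)) (z $ i) (xs $ i)"
    then show "exp_poly_density 1 (ebox (lo k) (up k)) (F k ys) \<and>
        (\<forall>q. exp_poly_density 1 (ebox (lo k) (up k)) q \<longrightarrow>
          exp_log_likelihood (p k ys) q \<le> exp_log_likelihood (p k ys) (F k ys)) \<longleftrightarrow>
      F k ys = robust_exp_density (ebox (lo k) (up k)) (lo k) (up k) z xs"
      unfolding z using nonneg one_finite[OF k]
      by (intro optimal_iff_robust_exp_density) auto
  qed
qed

end
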